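(* Consider the stochastic process generated by the stochastic SQP algorithm described in the context, with merit parameters $\mathcal{T}_k$ and true trial merit parameters $\mathcal{T}_k^{\mathrm{trial,true}}$. Suppose that for some $\tau_{\min}^{\mathrm{trial,true}}>0$ the event $E:=E_\tau(\tau_{\min}^{\mathrm{trial,true}})$ occurs (i.e., $\mathcal{T}_k^{\mathrm{trial,true}}\ge\tau_{\min}^{\mathrm{trial,true}}$ for all $k\in\mathbb{N}$ in all realizations of a run of the algorithm), that the sequences of parameters $\chi_k$, $\zeta_k$, $\xi_k$ are constant, and that there exists $p_\tau\in(0,1]$ such that for all $k\in\mathbb{N}$ and all signatures $(q_{[k]},w_{[k]})$ $$\mathbb{P}\left[\mathcal{T}_k<\mathcal{T}_{k-1}\,\middle|\,E,\ G_{[k-1]}\in N(q_{[k]},w_{[k]}),\ \mathcal{T}_k^{\mathrm{trial,true}}<\mathcal{T}_{k-1}\right]\ge p_\tau .$$ Then $$\mathbb{P}\left[\sum_{k=0}^\infty\mathcal{I}[\mathcal{T}_k^{\mathrm{trial,true}}<\mathcal{T}_k]<\infty\,\middle|\,E\right]=1,$$ where $\mathcal{I}[\cdot]$ is the indicator of an event.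
   Context: Problem: minimize $f(x)$ over $x\in\mathbb{R}^n$ subject to $c(x)=0$, where $f(x)=\mathbb{E}[F(x,\iota)]$, $\iota$ is a random variable, $c:\mathbb{R}^n\to\mathbb{R}^m$ with $m\le n$, and $J(x):=\nabla c(x)^T\in\mathbb{R}^{m\times n}$. Write $c_k=c(x_k)$, $J_k=J(x_k)$; $\mathbb{N}=\{0,1,2,\dots\}$; $[k]=\{0,\dots,k\}$. Standing assumptions. (A1) $\mathcal{X}\subseteq\mathbb{R}^n$ is an open convex set containing the iterates $\{x_k\}$ of every run. Over $\mathcal{X}$: $f$ is continuously differentiable and bounded, $\nabla f$ is bounded and Lipschitz with constant $L>0$; $c$ is continuously differentiable and bounded, $J$ is bounded and Lipschitz with constant $\Gamma>0$. (A2) The stochastic gradients $g_k$ satisfy $\mathbb{E}_k[g_k]=\nabla f(x_k)$ and $\mathbb{E}_k[\|g_k-\nabla f(x_k)\|_2^2]\le M$ with $M>0$, where $\mathbb{E}_k$ is expectation conditioned on the algorithm having reached $x_k$ as the $k$th iterate. (A3) $H_k\in\mathbb{R}^{n\times n}$ is symmetric, chosen independently of $g_k$, $\|H_k\|_2\le\kappa_H$, and $u^TH_ku\ge\zeta\|u\|_2^2$ for all $u\in\mathrm{Null}(J_k)$, with $\kappa_H,\zeta>0$ independent of $k$. Algorithm (stochastic SQP). Inputs: $L,\Gamma$; $\{\beta_k\}\subset(0,1]$; $x_0\in\mathbb{R}^n$; $\tau_{-1},\chi_{-1},\zeta_{-1},\xi_{-1},\omega,\epsilon_\chi>0$; $\epsilon_v\in(0,1]$;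 $\sigma,\epsilon_\tau,\epsilon_\zeta,\epsilon_\xi,\eta\in(0,1)$; $\theta\ge0$. Let $\Delta l(x,\tau,g,d):=-\tau g^Td+\|c(x)\|_2-\|c(x)+J(x)d\|_2$. For $k=0,1,2,\dots$: 1. If $J_k^Tc_k=0$ and $c_k\neq0$, terminate; it is assumed throughout that this never happens, so infinitely many iterates are generated. 2. Obtain $g_k$. 3. Compute (deterministically given $x_k$) $v_k\in\mathrm{Range}(J_k^T)$ with $\|v_k\|_2\le\omega\|J_k^Tc_k\|_2$ and $\|c_k\|_2-\|c_k+J_kv_k\|_2\ge\epsilon_v(\|c_k\|_2-\|c_k+\alpha_k^CJ_kv_k^C\|_2)$, where $v_k^C=-J_k^Tc_k$ and $\alpha_k^C$ minimizes $\frac12\|c_k+\alpha J_kv_k^C\|_2^2$ over $\alpha\in[0,\omega]$. 4. Compute $(u_k,y_k)$ solving $H_ku_k+J_k^Ty_k=-(g_k+H_kv_k)$, $J_ku_k=0$ ($u_k$ is unique); set $d_k=v_k+u_k$. 5. If $d_k=0$, set $\tau_k^{\mathrm{trial}}=\infty$, $(\tau_k,\chi_k,\zeta_k,\xi_k)=(\tau_{k-1},\chi_{k-1},\zeta_{k-1},\xi_{k-1})$ and $\alpha_k=1$. Otherwise: - $\tau_k^{\mathrm{trial}}=\infty$ if $g_k^Td_k+u_k^TH_ku_k\le0$, else $\tau_k^{\mathrm{trial}}=\frac{(1-\sigma)(\|c_k\|_2-\|c_k+J_kd_k\|_2)}{g_k^Td_k+u_k^TH_ku_k}$; $\tau_k=\tau_{k-1}$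 if $\tau_{k-1}\le\tau_k^{\mathrm{trial}}$, else $\tau_k=\min\{(1-\epsilon_\tau)\tau_{k-1},\tau_k^{\mathrm{trial}}\}$. - $(\chi_k,\zeta_k)=((1+\epsilon_\chi)\chi_{k-1},(1-\epsilon_\zeta)\zeta_{k-1})$ if $\|u_k\|_2^2\ge\chi_{k-1}\|v_k\|_2^2$ and $\frac12d_k^TH_kd_k<\frac14\zeta_{k-1}\|u_k\|_2^2$; else $(\chi_k,\zeta_k)=(\chi_{k-1},\zeta_{k-1})$. - $\xi_k^{\mathrm{trial}}=\frac{\Delta l(x_k,\tau_k,g_k,d_k)}{\tau_k\|d_k\|_2^2}$ if $\|u_k\|_2^2\ge\chi_k\|v_k\|_2^2$, else $\xi_k^{\mathrm{trial}}=\frac{\Delta l(x_k,\tau_k,g_k,d_k)}{\|d_k\|_2^2}$; $\xi_k=\xi_{k-1}$ if $\xi_{k-1}\le\xi_k^{\mathrm{trial}}$, else $\xi_k=\min\{(1-\epsilon_\xi)\xi_{k-1},\xi_k^{\mathrm{trial}}\}$. - $\alpha_k^{\mathrm{suff}}=\min\left\{\frac{2(1-\eta)\beta_k\Delta l(x_k,\tau_k,g_k,d_k)}{(\tau_kL+\Gamma)\|d_k\|_2^2},1\right\}$, and $\alpha_k$ is the projection of $\alpha_k^{\mathrm{suff}}$ onto $[a_k,a_k+\theta\beta_k^2]$, where $a_k=\frac{2(1-\eta)\beta_k\xi_k\tau_k}{\tau_kL+\Gamma}$ if $\|u_k\|_2^2\ge\chi_k\|v_k\|_2^2$ and $a_k=\frac{2(1-\eta)\beta_k\xi_k}{\tau_kL+\Gamma}$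 otherwise. 6. $x_{k+1}=x_k+\alpha_kd_k$. True quantities: conditioned on $x_k$, $u_k^{\mathrm{true}}$ is the vector $u_k$ that step 4 would give with $\nabla f(x_k)$ in place of $g_k$; $d_k^{\mathrm{true}}=v_k+u_k^{\mathrm{true}}$; $\tau_k^{\mathrm{trial,true}}$ is the value of $\tau_k^{\mathrm{trial}}$ obtained with $(\nabla f(x_k),u_k^{\mathrm{true}},d_k^{\mathrm{true}})$ in place of $(g_k,u_k,d_k)$. Stochastic process: the initial conditions are predetermined; $G_k$, $\mathcal{T}_k$, $\mathcal{T}_k^{\mathrm{trial,true}}$ denote the random variables whose realizations are $g_k$, $\tau_k$, $\tau_k^{\mathrm{trial,true}}$ ($\mathcal{T}_{-1}=\tau_{-1}$). The realization of $G_{[k-1]}=\{G_0,\dots,G_{k-1}\}$ determines everything the algorithm does before $g_k$ is drawn. Define $Q_k:=\mathcal{I}[\mathcal{T}_k^{\mathrm{trial,true}}<\mathcal{T}_{k-1}]$ and $W_k:=\sum_{i=0}^{k-1}\mathcal{I}[\mathcal{T}_i<\mathcal{T}_{i-1}]$. A signature up to iteration $k$ is a possible realization $(q_{[k]},w_{[k]})=(q_0,\dots,q_k,w_0,\dots,w_k)$ of $(Q_0,\dots,Q_k,W_0,\dots,W_k)$, and $G_{[k-1]}\in N(q_{[k]},w_{[k]})$ denotes the event that $Q_i=q_i$ and $W_i=w_i$ for all $i\in[k]$ ($G_{[-1]}\in N(q_0,w_0)$ has probability one). *)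

theory Defs
  imports "HOL-Probability.Probability"
begin

text \<open>
  One record collects the problem functions, the inputs of the algorithm and its deterministic
  choices. The normal step at iteration \<open>k\<close> is a function of the current iterate; the matrix
  \<open>H\<^sub>k\<close> is a function of the list \<open>[g\<^sub>0, \<dots>, g\<^bsub>k-1\<^esub>]\<close> of previous stochastic gradients, so it cannot
  depend on \<open>g\<^sub>k\<close>. The fields \<open>merit_init\<close>, \<open>chi_init\<close>, \<open>zeta_init\<close>, \<open>xi_init\<close> are the inputs with
  index \<open>-1\<close>.
\<close>

record ('n::finite, 'm::finite) sqp =
  obj :: "real ^ 'n \<Rightarrow> real"
  grad :: "real ^ 'n \<Rightarrow> real ^ 'n"
  con :: "real ^ 'n \<Rightarrow> real ^ 'm"
  jac :: "real ^ 'n \<Rightarrow> real ^ 'n ^ 'm"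
  lip_grad :: real   \<comment> \<open>\<open>L\<close>\<close>
  lip_jac :: real    \<comment> \<open>\<open>\<Gamma>\<close>\<close>
  step_beta :: "nat \<Rightarrow> real"
  x_init :: "real ^ 'n"
  merit_init :: real
  chi_init :: real
  zeta_init :: real
  xi_init :: real
  par_omega :: real
  par_sigma :: real
  par_eta :: real
  par_theta :: real
  eps_chi :: real
  eps_v :: real
  eps_tau :: real
  eps_zeta :: real
  eps_xi :: real
  normal_step :: "nat \<Rightarrow> real ^ 'n \<Rightarrow> real ^ 'n"
  hess :: "(real ^ 'n) list \<Rightarrow> real ^ 'n ^ 'n"

definition valid_inputs :: "('n::finite, 'm::finite) sqp \<Rightarrow> bool" where
  "valid_inputs A \<longleftrightarrow>
     lip_grad A > 0 \<and> lip_jac A > 0 \<and>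
     (\<forall>k. 0 < step_beta A k \<and> step_beta A k \<le> 1) \<and>
     merit_init A > 0 \<and> chi_init A > 0 \<and> zeta_init A > 0 \<and> xi_init A > 0 \<and>
     par_omega A > 0 \<and> eps_chi A > 0 \<and>
     0 < eps_v A \<and> eps_v A \<le> 1 \<and>
     par_sigma A \<in> {0<..<1} \<and> eps_tau A \<in> {0<..<1} \<and> eps_zeta A \<in> {0<..<1} \<and>
     eps_xi A \<in> {0<..<1} \<and> par_eta A \<in> {0<..<1} \<and>
     par_theta A \<ge> 0"


subsection \<open>One iteration\<close>

definition model_reduction ::
    "('n::finite, 'm::finite) sqp \<Rightarrow> real ^ 'n \<Rightarrow> real \<Rightarrow> real ^ 'n \<Rightarrow> real ^ 'n \<Rightarrow> real" where
  "model_reduction A x \<tau> g d =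
     - \<tau> * (g \<bullet> d) + norm (con A x) - norm (con A x + jac A x *v d)"

text \<open>
  The description is proper whenever \<open>H\<close> is symmetric and positive definite on the null space
  of \<open>J\<close>; the multiplier \<open>y\<close> itself need not be unique.
\<close>

definition tangential_step ::
    "real ^ 'n ^ 'm \<Rightarrow> real ^ 'n ^ 'n \<Rightarrow> real ^ 'n \<Rightarrow> real ^ 'n \<Rightarrow> real ^ 'n" where
  "tangential_step J H v g =
     (THE u. (\<exists>y. H *v u + transpose J *v y = - (g + H *v v)) \<and> J *v u = 0)"

definition tau_trial ::
    "('n::finite, 'm::finite) sqp \<Rightarrow> nat \<Rightarrow> real ^ 'n ^ 'n \<Rightarrow> real ^ 'n \<Rightarrow> real ^ 'n \<Rightarrow> ereal" where
  "tau_trial A k H x g =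
     (let v = normal_step A k x;
          u = tangential_step (jac A x) H v g;
          d = v + u
      in if d = 0 \<or> g \<bullet> d + u \<bullet> (H *v u) \<le> 0 then \<infinity>
         else ereal ((1 - par_sigma A) * (norm (con A x) - norm (con A x + jac A x *v d)) /
                     (g \<bullet> d + u \<bullet> (H *v u))))"

text \<open>
  The update rule shared by \<open>\<tau>\<close> and \<open>\<xi>\<close>. In the second branch \<open>trial\<close> is finite, because trial
  values are never \<open>-\<infinity>\<close>.
\<close>

definition reduce_parameter :: "real \<Rightarrow> real \<Rightarrow> ereal \<Rightarrow> real" where
  "reduce_parameter \<epsilon> old trial =
     (if ereal old \<le> trial then old else min ((1 - \<epsilon>) * old) (real_of_ereal trial))"

record ('n::finite) sqp_state =
  iterate :: "real ^ 'n"
  merit :: real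
  chi :: real
  zeta :: real
  xi :: real

definition sqp_step ::
    "('n::finite, 'm::finite) sqp \<Rightarrow> nat \<Rightarrow> real ^ 'n ^ 'n \<Rightarrow> real ^ 'n \<Rightarrow> 'n sqp_state \<Rightarrow> 'n sqp_state"
  where
  "sqp_step A k H g s =
     (let x = iterate s;
          v = normal_step A k x;
          u = tangential_step (jac A x) H v g;
          d = v + u
      in if d = 0 then s\<lparr>iterate := x + 1 *\<^sub>R d\<rparr>
         else
           let \<tau> = reduce_parameter (eps_tau A) (merit s) (tau_trial A k H x g);
               (chi_new, zeta_new) =
                 (if (norm u)\<^sup>2 \<ge> chi s * (norm v)\<^sup>2 \<and>
                     1 / 2 * (d \<bullet> (H *v d)) < 1 / 4 * zeta s * (norm u)\<^sup>2
                  then ((1 + eps_chi A) * chi s, (1 - eps_zeta A) * zeta s)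
                  else (chi s, zeta s));
               tangential = ((norm u)\<^sup>2 \<ge> chi_new * (norm v)\<^sup>2);
               \<Delta> = model_reduction A x \<tau> g d;
               \<xi>_trial = (if tangential then \<Delta> / (\<tau> * (norm d)\<^sup>2) else \<Delta> / (norm d)\<^sup>2);
               \<xi> = reduce_parameter (eps_xi A) (xi s) (ereal \<xi>_trial);
               \<beta> = step_beta A k;
               curv = \<tau> * lip_grad A + lip_jac A;
               \<alpha>_suff = min (2 * (1 - par_eta A) * \<beta> * \<Delta> / (curv * (norm d)\<^sup>2)) 1;
               a = (if tangential then 2 * (1 - par_eta A) * \<beta> * \<xi> * \<tau> / curv
                    else 2 * (1 - par_eta A) * \<beta> * \<xi> / curv);
               \<alpha> = closest_point {a .. a + par_theta A * \<beta>\<^sup>2} \<alpha>_suff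
           in \<lparr>iterate = x + \<alpha> *\<^sub>R d, merit = \<tau>, chi = chi_new, zeta = zeta_new, xi = \<xi>\<rparr>)"


subsection \<open>Runs\<close>

text \<open>
  A realization is a sequence \<open>g\<close> of stochastic gradients. The state \<open>sqp_run A g k\<close> is the one in
  which iteration \<open>k\<close> starts: it consists of \<open>x\<^sub>k\<close> together with
  \<open>\<tau>\<^bsub>k-1\<^esub>, \<chi>\<^bsub>k-1\<^esub>, \<zeta>\<^bsub>k-1\<^esub>, \<xi>\<^bsub>k-1\<^esub>\<close>.
\<close>

definition hess_at :: "('n::finite, 'm::finite) sqp \<Rightarrow> (nat \<Rightarrow> real ^ 'n) \<Rightarrow> nat \<Rightarrow> real ^ 'n ^ 'n" where
  "hess_at A g k = hess A (map g [0..<k])"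

primrec sqp_run :: "('n::finite, 'm::finite) sqp \<Rightarrow> (nat \<Rightarrow> real ^ 'n) \<Rightarrow> nat \<Rightarrow> 'n sqp_state" where
  "sqp_run A g 0 =
     \<lparr>iterate = x_init A, merit = merit_init A, chi = chi_init A, zeta = zeta_init A, xi = xi_init A\<rparr>"
| "sqp_run A g (Suc k) = sqp_step A k (hess_at A g k) (g k) (sqp_run A g k)"

definition x_at :: "('n::finite, 'm::finite) sqp \<Rightarrow> (nat \<Rightarrow> real ^ 'n) \<Rightarrow> nat \<Rightarrow> real ^ 'n" where
  "x_at A g k = iterate (sqp_run A g k)"

definition tau_prev :: "('n::finite, 'm::finite) sqp \<Rightarrow> (nat \<Rightarrow> real ^ 'n) \<Rightarrow> nat \<Rightarrow> real" where
  "tau_prev A g k = merit (sqp_run A g k)"   \<comment> \<open>\<open>\<tau>\<^bsub>k-1\<^esub>\<close>\<close>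

definition tau_at :: "('n::finite, 'm::finite) sqp \<Rightarrow> (nat \<Rightarrow> real ^ 'n) \<Rightarrow> nat \<Rightarrow> real" where
  "tau_at A g k = merit (sqp_run A g (Suc k))"   \<comment> \<open>\<open>\<tau>\<^sub>k\<close>\<close>

definition chi_at :: "('n::finite, 'm::finite) sqp \<Rightarrow> (nat \<Rightarrow> real ^ 'n) \<Rightarrow> nat \<Rightarrow> real" where
  "chi_at A g k = chi (sqp_run A g (Suc k))"

definition zeta_at :: "('n::finite, 'm::finite) sqp \<Rightarrow> (nat \<Rightarrow> real ^ 'n) \<Rightarrow> nat \<Rightarrow> real" where
  "zeta_at A g k = zeta (sqp_run A g (Suc k))"

definition xi_at :: "('n::finite, 'm::finite) sqp \<Rightarrow> (nat \<Rightarrow> real ^ 'n) \<Rightarrow> nat \<Rightarrow> real" where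
  "xi_at A g k = xi (sqp_run A g (Suc k))"

definition tau_true :: "('n::finite, 'm::finite) sqp \<Rightarrow> (nat \<Rightarrow> real ^ 'n) \<Rightarrow> nat \<Rightarrow> ereal" where
  "tau_true A g k = tau_trial A k (hess_at A g k) (x_at A g k) (grad A (x_at A g k))"

definition E_tau :: "('n::finite, 'm::finite) sqp \<Rightarrow> real \<Rightarrow> (nat \<Rightarrow> real ^ 'n) \<Rightarrow> bool" where
  "E_tau A \<tau>_min g \<longleftrightarrow> (\<forall>k. tau_true A g k \<ge> ereal \<tau>_min)"

definition Q_at :: "('n::finite, 'm::finite) sqp \<Rightarrow> (nat \<Rightarrow> real ^ 'n) \<Rightarrow> nat \<Rightarrow> nat" where
  "Q_at A g k = of_bool (tau_true A g k < ereal (tau_prev A g k))"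

definition W_at :: "('n::finite, 'm::finite) sqp \<Rightarrow> (nat \<Rightarrow> real ^ 'n) \<Rightarrow> nat \<Rightarrow> nat" where
  "W_at A g k = (\<Sum>i<k. of_bool (tau_at A g i < tau_prev A g i))"

text \<open>Only the entries of \<open>q\<close> and \<open>w\<close> with index at most \<open>k\<close> matter in the next two definitions.\<close>

definition in_N ::
    "('n::finite, 'm::finite) sqp \<Rightarrow> nat \<Rightarrow> (nat \<Rightarrow> nat) \<Rightarrow> (nat \<Rightarrow> nat) \<Rightarrow> (nat \<Rightarrow> real ^ 'n) \<Rightarrow> bool" where
  "in_N A k q w g \<longleftrightarrow> (\<forall>i\<le>k. Q_at A g i = q i \<and> W_at A g i = w i)"

definition is_signature ::
    "('n::finite, 'm::finite) sqp \<Rightarrow> 'w measure \<Rightarrow> ('w \<Rightarrow> nat \<Rightarrow> real ^ 'n) \<Rightarrow> nat \<Rightarrow>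
     (nat \<Rightarrow> nat) \<Rightarrow> (nat \<Rightarrow> nat) \<Rightarrow> bool" where
  "is_signature A M G k q w \<longleftrightarrow> (\<exists>\<omega>\<in>space M. in_N A k q w (G \<omega>))"


subsection \<open>Standing assumptions\<close>

text \<open>\<open>D\<close> is the law of the random variable inside the expectation that defines the objective.\<close>

definition expected_objective ::
    "('n::finite, 'm::finite) sqp \<Rightarrow> 'i measure \<Rightarrow> (real ^ 'n \<Rightarrow> 'i \<Rightarrow> real) \<Rightarrow> bool" where
  "expected_objective A D F \<longleftrightarrow>
     prob_space D \<and> (\<forall>x. integrable D (F x) \<and> obj A x = (\<integral>\<iota>. F x \<iota> \<partial>D))"

text \<open>
  The norm of the type of matrices is the Frobenius norm; the matrix 2-norm is the operator norm
  of the induced linear map.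
\<close>

definition smooth_problem :: "('n::finite, 'm::finite) sqp \<Rightarrow> (real ^ 'n) set \<Rightarrow> bool" where
  "smooth_problem A X \<longleftrightarrow>
     open X \<and> convex X \<and>
     (\<forall>x\<in>X. GDERIV (obj A) x :> grad A x) \<and> continuous_on X (grad A) \<and>
     bounded (obj A ` X) \<and> bounded (grad A ` X) \<and>
     (lip_grad A)-lipschitz_on X (grad A) \<and>
     (\<forall>x\<in>X. (con A has_derivative (\<lambda>h. jac A x *v h)) (at x)) \<and> continuous_on X (jac A) \<and>
     bounded (con A ` X) \<and> bounded (jac A ` X) \<and>
     (\<forall>x\<in>X. \<forall>y\<in>X. onorm (\<lambda>h. (jac A x - jac A y) *v h) \<le> lip_jac A * dist x y)"

definition stochastic_gradients ::
    "('n::finite, 'm::finite) sqp \<Rightarrow> 'w measure \<Rightarrow> ('w \<Rightarrow> nat \<Rightarrow> real ^ 'n) \<Rightarrow> real \<Rightarrow> bool" where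
  "stochastic_gradients A M G Mg \<longleftrightarrow>
     (\<forall>k. let x = (\<lambda>\<omega>. x_at A (G \<omega>) k);
              \<F> = vimage_algebra (space M) x borel
          in integrable M (\<lambda>\<omega>. G \<omega> k) \<and>
             (\<forall>i. AE \<omega> in M. real_cond_exp M \<F> (\<lambda>\<omega>. G \<omega> k $ i) \<omega> = grad A (x \<omega>) $ i) \<and>
             (AE \<omega> in M. nn_cond_exp M \<F> (\<lambda>\<omega>. ennreal ((norm (G \<omega> k - grad A (x \<omega>)))\<^sup>2)) \<omega>
                           \<le> ennreal Mg))"

definition admissible_hessian ::
    "real ^ 'n ^ 'm \<Rightarrow> real ^ 'n ^ 'n \<Rightarrow> real \<Rightarrow> real \<Rightarrow> bool" where
  "admissible_hessian J H \<kappa>\<^sub>H \<zeta> \<longleftrightarrow>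
     transpose H = H \<and> onorm (\<lambda>h. H *v h) \<le> \<kappa>\<^sub>H \<and>
     (\<forall>u. J *v u = 0 \<longrightarrow> u \<bullet> (H *v u) \<ge> \<zeta> * (norm u)\<^sup>2)"

definition admissible_normal_step ::
    "real ^ 'm \<Rightarrow> real ^ 'n ^ 'm \<Rightarrow> real \<Rightarrow> real \<Rightarrow> real ^ 'n \<Rightarrow> bool" where
  "admissible_normal_step c J \<omega> \<epsilon> v \<longleftrightarrow>
     v \<in> range (\<lambda>y. transpose J *v y) \<and>
     norm v \<le> \<omega> * norm (transpose J *v c) \<and>
     (let v\<^sub>C = - (transpose J *v c)
      in \<exists>\<alpha>\<^sub>C. is_arg_min (\<lambda>\<alpha>. 1 / 2 * (norm (c + \<alpha> *\<^sub>R (J *v v\<^sub>C)))\<^sup>2) (\<lambda>\<alpha>. \<alpha> \<in> {0..\<omega>}) \<alpha>\<^sub>C \<and>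
              norm c - norm (c + J *v v) \<ge> \<epsilon> * (norm c - norm (c + \<alpha>\<^sub>C *\<^sub>R (J *v v\<^sub>C))))"

text \<open>Every realization of the gradients yields a run that never terminates.\<close>

definition admissible_runs ::
    "('n::finite, 'm::finite) sqp \<Rightarrow> (real ^ 'n) set \<Rightarrow> real \<Rightarrow> real \<Rightarrow> 'w measure \<Rightarrow>
     ('w \<Rightarrow> nat \<Rightarrow> real ^ 'n) \<Rightarrow> bool" where
  "admissible_runs A X \<kappa>\<^sub>H \<zeta> M G \<longleftrightarrow>
     (\<forall>\<omega>\<in>space M. \<forall>k. let x = x_at A (G \<omega>) k; c = con A x; J = jac A x in
        x \<in> X \<and>
        \<not> (transpose J *v c = 0 \<and> c \<noteq> 0) \<and>
        admissible_normal_step c J (par_omega A) (eps_v A) (normal_step A k x) \<and>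
        admissible_hessian J (hess_at A (G \<omega>) k) \<kappa>\<^sub>H \<zeta>)"

definition random_process ::
    "('n::finite, 'm::finite) sqp \<Rightarrow> 'w measure \<Rightarrow> ('w \<Rightarrow> nat \<Rightarrow> real ^ 'n) \<Rightarrow> bool" where
  "random_process A M G \<longleftrightarrow>
     prob_space M \<and>
     (\<forall>k. (\<lambda>\<omega>. G \<omega> k) \<in> borel_measurable M \<and>
          (\<lambda>\<omega>. x_at A (G \<omega>) k) \<in> borel_measurable M \<and>
          (\<lambda>\<omega>. tau_at A (G \<omega>) k) \<in> borel_measurable M \<and>
          (\<lambda>\<omega>. tau_true A (G \<omega>) k) \<in> borel_measurable M)"

end

theory Submission
  imports Defs
begin

text \<open>
  On the event \<open>E\<close>, iteration \<open>k\<close> can have \<open>\<T>\<^bsub>k\<^esub>\<^bsup>trial,true\<^esup> < \<T>\<^bsub>k-1\<^esub>\<close> only if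
  \<open>\<T>\<^bsub>k-1\<^esub> > \<tau>\<^bsub>min\<^esub>\<close>. As each decrease of the merit parameter is by a factor of at most
  \<open>1 - \<epsilon>\<^sub>\<tau>\<close>, the number of such iterations that also decrease the merit parameter is bounded by a
  constant \<open>s\<close>. Summing the conditional lower bound \<open>p\<close> over the finitely many signatures, the
  probability of such a decrease at \<open>k\<close> is at least \<open>p\<close> times the probability of
  \<open>E \<inter> {\<T>\<^bsub>k\<^esub>\<^bsup>trial,true\<^esup> < \<T>\<^bsub>k-1\<^esub>}\<close>. The probabilities of the latter events therefore sum
  to at most \<open>s / p\<close>, and the Borel--Cantelli lemma applies.
\<close>

text \<open>Each counted decrease costs a factor \<open>r\<close>, so a value still above
  \<open>lb\<close> is at most \<open>t 0\<close> times \<open>r\<close> to the number of decreases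
  so far. After \<open>s\<close> of them this bound is at most \<open>lb\<close>, and nothing
  further is counted.\<close>

lemma bounded_count_of_geometric_decrease:
  fixes t :: "nat \<Rightarrow> real"
  assumes mono: "\<And>k. t (Suc k) \<le> t k"
    and geometric: "\<And>k. t (Suc k) < t k \<Longrightarrow> lb < t k \<Longrightarrow> t (Suc k) \<le> r * t k"
    and "0 \<le> r" and small: "r ^ s * t 0 \<le> lb" and "r \<le> 1" and "0 \<le> t 0"
  shows "(\<Sum>k<n. of_bool (lb < t k \<and> t (Suc k) < t k) :: nat) \<le> s"
proof -
  let ?c = "\<lambda>n. \<Sum>k<n. of_bool (lb < t k \<and> t (Suc k) < t k) :: nat"
  \<comment> \<open>By monotonicity, \<open>t n\<close> above \<open>lb\<close> means that all
    earlier values were too, so the count includes every decrease before \<open>n\<close>.\<close>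
  have above: "lb < t n \<longrightarrow> t n \<le> r ^ ?c n * t 0" for n
  proof (induction n)
    case (Suc n)
    show ?case
    proof
      assume "lb < t (Suc n)"
      with mono[of n] have "lb < t n" by linarith
      with Suc have IH: "t n \<le> r ^ ?c n * t 0" by blast
      show "t (Suc n) \<le> r ^ ?c (Suc n) * t 0"
      proof (cases "t (Suc n) < t n")
        case True
        then have "t (Suc n) \<le> r * t n" using geometric \<open>lb < t n\<close> by blast
        also have "\<dots> \<le> r * (r ^ ?c n * t 0)" using IH \<open>0 \<le> r\<close> by (rule mult_left_mono)
        finally show ?thesis using True \<open>lb < t n\<close> by simp
      next
        case False
        then show ?thesis using IH mono[of n] by simp
      qed
    qed
  qed simp
  show ?thesis
  proof (induction n)
    case (Suc n)
    show ?case
    proof (cases "lb < t n")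
      case True
      \<comment> \<open>Strictness leaves room for the decrease that index \<open>n\<close> itself
        may add.\<close>
      have "?c n < s"
      proof (rule ccontr)
        assume "\<not> ?c n < s"
        then have "r ^ ?c n \<le> r ^ s" using \<open>0 \<le> r\<close> \<open>r \<le> 1\<close> by (intro power_decreasing) auto
        then have "r ^ ?c n * t 0 \<le> r ^ s * t 0" using \<open>0 \<le> t 0\<close> by (rule mult_right_mono)
        then show False using above[of n] True small by linarith
      qed
      then show ?thesis by (simp add: of_bool_def)
    next
      case False
      then show ?thesis using Suc by simp
    qed
  qed simp
qed

text \<open>Total probability: the finitely many level sets of \<open>f\<close> partition both
  \<open>B\<close> and its subset \<open>C\<close>, so a ratio valid on each level set adds
  up.\<close>

lemma (in finite_measure) measure_ratio_of_partition:
  assumes "finite S" and "\<And>x. x \<in> B \<Longrightarrow> f x \<in> S" and "C \<subseteq> B"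
    and B: "\<And>a. {x \<in> B. f x = a} \<in> sets M" and C: "\<And>a. {x \<in> C. f x = a} \<in> sets M"
    and ratio: "\<And>a. p * measure M {x \<in> B. f x = a} \<le> measure M {x \<in> C. f x = a}"
  shows "p * measure M B \<le> measure M C"
proof -
  have split: "measure M Y = (\<Sum>a\<in>S. measure M {x \<in> Y. f x = a})"
    if "Y \<subseteq> B" and "\<And>a. {x \<in> Y. f x = a} \<in> sets M" for Y
  proof -
    have "Y = (\<Union>a\<in>S. {x \<in> Y. f x = a})" using assms(2) that(1) by auto
    also have "measure M \<dots> = (\<Sum>a\<in>S. measure M {x \<in> Y. f x = a})"
      using that(2) \<open>finite S\<close>
      by (intro finite_measure_finite_Union) (auto simp: disjoint_family_on_def)
    finally show ?thesis .
  qed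
  have "p * measure M B = (\<Sum>a\<in>S. p * measure M {x \<in> B. f x = a})"
    using split[of B] B by (simp add: sum_distrib_left)
  also have "\<dots> \<le> (\<Sum>a\<in>S. measure M {x \<in> C. f x = a})"
    by (intro sum_mono ratio)
  also have "\<dots> = measure M C" using split[of C] C \<open>C \<subseteq> B\<close> by simp
  finally show ?thesis .
qed

text \<open>Think of \<open>B k\<close> as an attempt and of \<open>C k\<close> as its success. The
  expected number of successes is at most \<open>s\<close>, which makes the probabilities of the
  attempts summable.\<close>

lemma (in prob_space) AE_eventually_not_of_bounded_successes:
  fixes B C :: "nat \<Rightarrow> 'a set" and s :: nat
  assumes [measurable]: "\<And>k. B k \<in> events" "\<And>k. C k \<in> events"
    and ratio: "\<And>k. p * prob (B k) \<le> prob (C k)" and "0 < p"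
    and count: "\<And>x n. x \<in> space M \<Longrightarrow> (\<Sum>k<n. of_bool (x \<in> C k) :: nat) \<le> s"
  shows "AE x in M. eventually (\<lambda>k. x \<notin> B k) sequentially"
proof -
  have partial: "(\<Sum>k<n. prob (B k)) \<le> s / p" for n
  proof -
    have "p * (\<Sum>k<n. prob (B k)) \<le> (\<Sum>k<n. prob (C k))"
      unfolding sum_distrib_left by (intro sum_mono ratio)
    also have "\<dots> = expectation (\<lambda>x. \<Sum>k<n. indicator (C k) x)"
      by (subst Bochner_Integration.integral_sum) (auto simp: emeasure_eq_measure)
    also have "\<dots> \<le> real s"
    proof (rule integral_le_const)
      show "integrable M (\<lambda>x. \<Sum>k<n. indicator (C k) x :: real)"
        by (auto simp: emeasure_eq_measure)
      have "(\<Sum>k<n. indicator (C k) x :: real) \<le> real s" if "x \<in> space M" for x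
      proof -
        have "(\<Sum>k<n. indicator (C k) x :: real) = real (\<Sum>k<n. of_bool (x \<in> C k))"
          unfolding of_nat_sum by (intro sum.cong) (auto simp: indicator_def)
        then show ?thesis using count[OF that, of n] by linarith
      qed
      then show "AE x in M. (\<Sum>k<n. indicator (C k) x :: real) \<le> real s" by simp
    qed
    finally show ?thesis using \<open>0 < p\<close> by (simp add: field_simps)
  qed
  have "summable (\<lambda>k. prob (B k))"
    by (rule summableI_nonneg_bounded[OF _ partial]) simp
  then have "AE x in M. eventually (\<lambda>k. x \<in> space M - B k) sequentially"
    by (intro borel_cantelli_AE1) (auto simp: emeasure_eq_measure)
  then show ?thesis by (auto elim: eventually_mono)
qed

lemma tau_prev_Suc: "tau_prev A g (Suc k) = tau_at A g k"
  by (simp add: tau_prev_def tau_at_def)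

lemma tau_trial_not_MInfty: "tau_trial A k H x g \<noteq> - \<infinity>"
  by (simp add: tau_trial_def Let_def)

text \<open>The separate case \<open>d = 0\<close> of \<open>sqp_step\<close> fits the same rule:
  the trial value is then infinite, so the old parameter is kept.\<close>

lemma tau_at_eq_reduce_parameter:
  "tau_at A g k = reduce_parameter (eps_tau A) (tau_prev A g k)
     (tau_trial A k (hess_at A g k) (x_at A g k) (g k))"
  by (auto simp: tau_at_def tau_prev_def x_at_def sqp_step_def Let_def tau_trial_def
      reduce_parameter_def)

text \<open>At \<open>- \<infinity>\<close> the default value 0 of \<open>real_of_ereal\<close>
  could make the result exceed a negative \<open>old\<close>.\<close>

lemma reduce_parameter_le:
  assumes "trial \<noteq> - \<infinity>"
  shows "reduce_parameter \<epsilon> old trial \<le> old"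
  using assms by (cases trial) (auto simp: reduce_parameter_def)

lemma tau_at_le: "tau_at A g k \<le> tau_prev A g k"
  unfolding tau_at_eq_reduce_parameter by (intro reduce_parameter_le tau_trial_not_MInfty)

text \<open>A strict decrease can only come from the second branch of
  \<open>reduce_parameter\<close>, where the minimum supplies the factor.\<close>

lemma tau_at_decrease:
  assumes "tau_at A g k < tau_prev A g k"
  shows "tau_at A g k \<le> (1 - eps_tau A) * tau_prev A g k"
  using assms unfolding tau_at_eq_reduce_parameter
  by (auto simp: reduce_parameter_def split: if_splits)

text \<open>Infinitely many pairs of functions \<open>q\<close>, \<open>w\<close> describe the same
  event \<open>in_N A k q w\<close>. Lists of length \<open>Suc k\<close> remove this redundancy and
  can label a finite partition.\<close>

definition signature :: "('n::finite, 'm::finite) sqp \<Rightarrow> nat \<Rightarrow> (nat \<Rightarrow> real ^ 'n) \<Rightarrow> (nat \<times> nat) list"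
  where "signature A k g = map (\<lambda>i. (Q_at A g i, W_at A g i)) [0..<Suc k]"

lemma W_at_le: "W_at A g k \<le> k"
proof -
  have "W_at A g k \<le> (\<Sum>i<k. 1)" unfolding W_at_def by (intro sum_mono) auto
  then show ?thesis by simp
qed

lemma signature_in_finite:
  "signature A k g \<in> {xs. set xs \<subseteq> {..1} \<times> {..k} \<and> length xs = Suc k}"
proof -
  have "W_at A g i \<le> k" if "i \<le> k" for i using W_at_le[of A g i] that by linarith
  then show ?thesis by (auto simp: signature_def Q_at_def simp del: upt_Suc)
qed

text \<open>Allows a hypothesis stated with \<open>in_N\<close> to be applied to the level sets of
  \<open>signature\<close>.\<close>

lemma signature_eq_iff:
  "signature A k g = xs \<longleftrightarrow>
     length xs = Suc k \<and> in_N A k (\<lambda>i. fst (xs ! i)) (\<lambda>i. snd (xs ! i)) g"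
  by (auto simp: signature_def in_N_def list_eq_iff_nth_eq less_Suc_eq_le prod_eq_iff
      simp del: upt_Suc)

theorem theorem5:
  fixes A :: "('n::finite, 'm::finite) sqp"
    and D :: "'i measure" and F :: "real ^ 'n \<Rightarrow> 'i \<Rightarrow> real"
    and X :: "(real ^ 'n) set"
    and M :: "'w measure" and G :: "'w \<Rightarrow> nat \<Rightarrow> real ^ 'n"
    and Mg \<kappa>\<^sub>H \<zeta> \<tau>_min p :: real
  assumes "CARD('m) \<le> CARD('n)"
    and "valid_inputs A"
    and "expected_objective A D F"
    and "smooth_problem A X"
    and "random_process A M G"
    and "Mg > 0" and "stochastic_gradients A M G Mg"
    and "\<kappa>\<^sub>H > 0" and "\<zeta> > 0" and "admissible_runs A X \<kappa>\<^sub>H \<zeta> M G"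
    and "\<tau>_min > 0"
    and "\<P>(\<omega> in M. E_tau A \<tau>_min (G \<omega>)) > 0"
    and "\<And>\<omega> k. \<omega> \<in> space M \<Longrightarrow> E_tau A \<tau>_min (G \<omega>) \<Longrightarrow>
           chi_at A (G \<omega>) k = chi_at A (G \<omega>) 0 \<and>
           zeta_at A (G \<omega>) k = zeta_at A (G \<omega>) 0 \<and>
           xi_at A (G \<omega>) k = xi_at A (G \<omega>) 0"
    and "0 < p" and "p \<le> 1"
    and "\<And>k q w. is_signature A M G k q w \<Longrightarrow>
           \<P>(\<omega> in M. E_tau A \<tau>_min (G \<omega>) \<and> in_N A k q w (G \<omega>) \<and>
                     tau_true A (G \<omega>) k < ereal (tau_prev A (G \<omega>) k)) > 0 \<Longrightarrow>
           \<P>(\<omega> in M. tau_at A (G \<omega>) k < tau_prev A (G \<omega>) k \<bar>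
                     E_tau A \<tau>_min (G \<omega>) \<and> in_N A k q w (G \<omega>) \<and>
                     tau_true A (G \<omega>) k < ereal (tau_prev A (G \<omega>) k)) \<ge> p"
  shows "\<P>(\<omega> in M. (\<Sum>k. of_bool (tau_true A (G \<omega>) k < ereal (tau_at A (G \<omega>) k)) :: ennreal) < \<infinity> \<bar>
                   E_tau A \<tau>_min (G \<omega>)) = 1"
proof -
  interpret prob_space M using \<open>random_process A M G\<close> by (simp add: random_process_def)
  define E where "E \<omega> \<longleftrightarrow> E_tau A \<tau>_min (G \<omega>)" for \<omega>
  define Q where "Q k \<omega> \<longleftrightarrow> tau_true A (G \<omega>) k < ereal (tau_prev A (G \<omega>) k)" for k \<omega>
  define R where "R k \<omega> \<longleftrightarrow> tau_at A (G \<omega>) k < tau_prev A (G \<omega>) k" for k \<omega>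
  define B where "B k = {\<omega> \<in> space M. E \<omega> \<and> Q k \<omega>}" for k
  define C where "C k = {\<omega> \<in> B k. R k \<omega>}" for k
  have [measurable]: "(\<lambda>\<omega>. tau_at A (G \<omega>) k) \<in> borel_measurable M"
      "(\<lambda>\<omega>. tau_true A (G \<omega>) k) \<in> borel_measurable M" for k
    using \<open>random_process A M G\<close> by (auto simp: random_process_def)
  \<comment> \<open>At index 0 this is the constant \<open>merit_init A\<close>; later indices shift
    to \<open>tau_at\<close>.\<close>
  have [measurable]: "(\<lambda>\<omega>. tau_prev A (G \<omega>) k) \<in> borel_measurable M" for k
    by (cases k) (simp_all add: tau_prev_Suc, simp add: tau_prev_def)
  have [measurable]: "Measurable.pred M E" unfolding E_def E_tau_def by measurable
  have [measurable]: "Measurable.pred M (Q k)" "Measurable.pred M (R k)" for k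
    unfolding Q_def R_def by measurable
  have [measurable]: "Measurable.pred M (\<lambda>\<omega>. in_N A k q w (G \<omega>))" for k q w
    unfolding in_N_def Q_at_def W_at_def by measurable
  have [measurable]: "Measurable.pred M (\<lambda>\<omega>. signature A k (G \<omega>) = xs)" for k xs
    unfolding signature_eq_iff by measurable
  have [measurable]: "B k \<in> events" "C k \<in> events" for k
    unfolding C_def B_def by measurable

  have ratio: "p * prob (B k) \<le> prob (C k)" for k
  proof (rule measure_ratio_of_partition[where f = "\<lambda>\<omega>. signature A k (G \<omega>)"])
    show "finite {xs :: (nat \<times> nat) list. set xs \<subseteq> {..1} \<times> {..k} \<and> length xs = Suc k}"
      by (intro finite_lists_length_eq) simp
    show "signature A k (G \<omega>) \<in> {xs. set xs \<subseteq> {..1} \<times> {..k} \<and> length xs = Suc k}" for \<omega>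
      by (rule signature_in_finite)
    show "C k \<subseteq> B k" by (auto simp: C_def)
    show "{\<omega> \<in> B k. signature A k (G \<omega>) = xs} \<in> events" for xs
      unfolding B_def by measurable
    show "{\<omega> \<in> C k. signature A k (G \<omega>) = xs} \<in> events" for xs
      unfolding C_def B_def by measurable
    \<comment> \<open>For a null level set the left side vanishes. Otherwise the level set is
      nonempty, so \<open>xs\<close> is realized and the conditional bound applies.\<close>
    show "p * prob {\<omega> \<in> B k. signature A k (G \<omega>) = xs}
            \<le> prob {\<omega> \<in> C k. signature A k (G \<omega>) = xs}" for xs
    proof (cases "prob {\<omega> \<in> B k. signature A k (G \<omega>) = xs} = 0")
      case False
      define q w where "q = (\<lambda>i. fst (xs ! i))" and "w = (\<lambda>i. snd (xs ! i))"
      have "{\<omega> \<in> B k. signature A k (G \<omega>) = xs} \<noteq> {}"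
        using False by (metis measure_empty)
      then obtain \<omega>\<^sub>0 where \<omega>\<^sub>0: "\<omega>\<^sub>0 \<in> space M" "signature A k (G \<omega>\<^sub>0) = xs"
        by (auto simp: B_def)
      then have len: "length xs = Suc k" and sig: "is_signature A M G k q w"
        unfolding is_signature_def by (auto simp: signature_eq_iff q_def w_def)
      have B_eq: "{\<omega> \<in> B k. signature A k (G \<omega>) = xs} =
          {\<omega> \<in> space M. E \<omega> \<and> in_N A k q w (G \<omega>) \<and> Q k \<omega>}"
        using len by (auto simp: B_def signature_eq_iff q_def w_def)
      have C_eq: "{\<omega> \<in> C k. signature A k (G \<omega>) = xs} =
          {\<omega> \<in> space M. R k \<omega> \<and> E \<omega> \<and> in_N A k q w (G \<omega>) \<and> Q k \<omega>}"
        using len by (auto simp: B_def C_def signature_eq_iff q_def w_def)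
      have pos: "prob {\<omega> \<in> space M. E \<omega> \<and> in_N A k q w (G \<omega>) \<and> Q k \<omega>} > 0"
        using False unfolding B_eq by (simp add: zero_less_measure_iff)
      then have "\<P>(\<omega> in M. R k \<omega> \<bar> E \<omega> \<and> in_N A k q w (G \<omega>) \<and> Q k \<omega>) \<ge> p"
        using assms(16)[OF sig] unfolding E_def Q_def R_def by blast
      then show ?thesis
        using pos unfolding B_eq C_eq cond_prob_def by (simp add: pos_le_divide_eq)
    qed simp
  qed

  have \<epsilon>: "0 < eps_tau A" "eps_tau A < 1" and \<tau>\<^sub>0: "0 < merit_init A"
    using \<open>valid_inputs A\<close> by (auto simp: valid_inputs_def)
  \<comment> \<open>\<open>s\<close> will be a number of geometric reductions that takes the initial
    merit parameter below \<open>\<tau>_min\<close>.\<close>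
  have "(\<lambda>s. (1 - eps_tau A) ^ s * merit_init A) \<longlonglongrightarrow> 0 * merit_init A"
    using \<epsilon> by (intro tendsto_mult LIMSEQ_power_zero tendsto_const) simp
  then have "eventually (\<lambda>s. (1 - eps_tau A) ^ s * merit_init A < \<tau>_min) sequentially"
    using \<open>\<tau>_min > 0\<close> by (auto dest: order_tendstoD(2))
  then obtain s where s: "(1 - eps_tau A) ^ s * merit_init A < \<tau>_min"
    by (auto simp: eventually_sequentially)

  have count: "(\<Sum>k<n. of_bool (\<omega> \<in> C k) :: nat) \<le> s" for \<omega> n
  proof -
    \<comment> \<open>The index is shifted by one: \<open>?t 0\<close> is the initial value and
      \<open>?t (Suc k)\<close> is the parameter after iteration \<open>k\<close>.\<close>
    let ?t = "tau_prev A (G \<omega>)"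
    have "\<tau>_min < ?t k \<and> ?t (Suc k) < ?t k" if "\<omega> \<in> C k" for k
    proof -
      have "ereal \<tau>_min \<le> tau_true A (G \<omega>) k" "tau_true A (G \<omega>) k < ereal (?t k)"
        using that by (auto simp: C_def B_def E_def E_tau_def Q_def)
      then have "ereal \<tau>_min < ereal (?t k)" by (rule le_less_trans)
      then show ?thesis using that by (auto simp: C_def R_def tau_prev_Suc)
    qed
    then have "(\<Sum>k<n. of_bool (\<omega> \<in> C k) :: nat)
        \<le> (\<Sum>k<n. of_bool (\<tau>_min < ?t k \<and> ?t (Suc k) < ?t k))"
      by (intro sum_mono) auto
    also have "\<dots> \<le> s"
      using s \<epsilon> \<tau>\<^sub>0 tau_at_le tau_at_decrease
      by (intro bounded_count_of_geometric_decrease[where r = "1 - eps_tau A"])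
        (auto simp: tau_prev_Suc, auto simp: tau_prev_def)
    finally show ?thesis .
  qed

  define f where "f k \<omega> = (of_bool (tau_true A (G \<omega>) k < ereal (tau_at A (G \<omega>) k)) :: ennreal)"
    for k \<omega>
  have [measurable]: "f k \<in> borel_measurable M" for k
    unfolding f_def of_bool_def by measurable
  have "AE \<omega> in M. eventually (\<lambda>k. \<omega> \<notin> B k) sequentially"
    using AE_eventually_not_of_bounded_successes[OF _ _ ratio \<open>0 < p\<close> count] by simp
  with AE_space have ae: "AE \<omega> in M. E \<omega> \<longrightarrow> (\<Sum>k. f k \<omega>) < \<infinity>"
  proof eventually_elim
    case (elim \<omega>)
    show ?case
    proof
      assume "E \<omega>"
      obtain N where N: "\<And>k. N \<le> k \<Longrightarrow> \<omega> \<notin> B k"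
        using elim(2) by (auto simp: eventually_sequentially)
      have "f k \<omega> = 0" if "N \<le> k" for k
      proof -
        have "\<not> Q k \<omega>" using N[OF that] elim(1) \<open>E \<omega>\<close> by (simp add: B_def)
        \<comment> \<open>\<open>Q k\<close> compares with the parameter before iteration
          \<open>k\<close>, the claim with the one after it. The latter is no larger, so failure of
          \<open>Q k\<close> is enough.\<close>
        then have "\<not> tau_true A (G \<omega>) k < ereal (tau_at A (G \<omega>) k)"
          using tau_at_le[of A "G \<omega>" k] unfolding Q_def
          by (meson ereal_less_eq(3) less_le_trans)
        then show ?thesis by (simp add: f_def)
      qed
      then have "(\<Sum>k. f k \<omega>) = (\<Sum>k<N. f k \<omega>)" by (intro suminf_finite) auto
      also have "\<dots> < \<infinity>" by (simp add: f_def of_bool_def less_top)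
      finally show "(\<Sum>k. f k \<omega>) < \<infinity>" .
    qed
  qed
  \<comment> \<open>Numerator and denominator of the conditional probability agree, since their
    events differ by a null set.\<close>
  have "prob {\<omega> \<in> space M. (\<Sum>k. f k \<omega>) < \<infinity> \<and> E \<omega>} = prob {\<omega> \<in> space M. E \<omega>}"
    using ae by (intro finite_measure_eq_AE) auto
  then show ?thesis
    using \<open>\<P>(\<omega> in M. E_tau A \<tau>_min (G \<omega>)) > 0\<close> unfolding cond_prob_def f_def E_def by simp
qed

end
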